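(* Let $T=\mathrm{PSL}(2,9)$ and let $G=T\times T$ act on $\Omega=T$ in its diagonal action, $t^{(x,y)}=x^{-1}ty$. Then $G$ is non-synchronising on $\Omega$.
   Context: A group $G$ acting on a finite set $\Omega$ is synchronising if for every non-bijective map $f:\Omega\to\Omega$, the transformation semigroup $\langle G,f\rangle$ generated by (the permutations induced by) $G$ and $f$ contains a constant map; otherwise $G$ is non-synchronising. For a group $T$, the diagonal action of $T\times T$ on $T$ is given by $t^{(x,y)}:=x^{-1}ty$. *)

theory Defs
  imports "HOL-Analysis.Determinants" "HOL-Algebra.Coset"
begin

definition SL :: "('a::field ^ 'n ^ 'n) monoid" where
  "SL = \<lparr>carrier = {A. det A = 1}, mult = (**), one = mat 1\<rparr>"

definition center :: "('g, 'm) monoid_scheme \<Rightarrow> 'g set" where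
  "center G = {z \<in> carrier G. \<forall>x \<in> carrier G. z \<otimes>\<^bsub>G\<^esub> x = x \<otimes>\<^bsub>G\<^esub> z}"

(* PSL(n,q) is the instance CARD('n) = n, CARD('a) = q. *)
definition PSL :: "('a::field ^ 'n ^ 'n) set monoid" where
  "PSL = SL Mod center SL"

lemma group_SL: "group (SL :: ('a::field ^ 'n ^ 'n) monoid)"
proof (rule groupI)
  fix A :: "'a ^ 'n ^ 'n"
  assume A: "A \<in> carrier SL"
  then have "invertible A" by (simp add: SL_def invertible_det_nz)
  then obtain B where B: "B ** A = mat 1" unfolding invertible_left_inverse by blast
  then have "det B * det A = 1" by (metis det_I det_mul)
  with A have "B \<in> carrier SL" by (simp add: SL_def)
  with B show "\<exists>B\<in>carrier SL. B \<otimes>\<^bsub>SL\<^esub> A = \<one>\<^bsub>SL\<^esub>"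
    by (intro bexI[of _ B]) (simp_all add: SL_def)
qed (simp_all add: SL_def det_mul matrix_mul_assoc)

lemma (in group) center_normal: "center G \<lhd> G"
proof -
  have closed: "z \<in> carrier G" if "z \<in> center G" for z
    using that unfolding center_def by blast
  have comm: "z \<otimes> x = x \<otimes> z" if "z \<in> center G" "x \<in> carrier G" for z x
    using that unfolding center_def by blast
  have centerI: "z \<in> center G" if "z \<in> carrier G" "\<And>x. x \<in> carrier G \<Longrightarrow> z \<otimes> x = x \<otimes> z" for z
    using that unfolding center_def by blast
  have "subgroup (center G) G"
  proof (rule subgroupI)
    show "center G \<subseteq> carrier G" using closed by blast
    have "\<one> \<in> center G" by (rule centerI) simp_all
    then show "center G \<noteq> {}" by blast
  next
    fix a assume a: "a \<in> center G"
    note ca = closed[OF a]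
    show "inv a \<in> center G"
    proof (rule centerI)
      fix x assume x: "x \<in> carrier G"
      have "inv (a \<otimes> inv x) = inv (inv x \<otimes> a)" by (simp only: comm[OF a inv_closed[OF x]])
      then show "inv a \<otimes> x = x \<otimes> inv a" using ca x by (simp add: inv_mult_group)
    qed (simp add: ca)
  next
    fix a b assume a: "a \<in> center G" and b: "b \<in> center G"
    note c = closed[OF a] closed[OF b]
    show "a \<otimes> b \<in> center G"
    proof (rule centerI)
      fix x assume x: "x \<in> carrier G"
      have "a \<otimes> b \<otimes> x = a \<otimes> x \<otimes> b" using c x by (simp add: m_assoc comm[OF b x])
      also have "\<dots> = x \<otimes> (a \<otimes> b)" using c x by (simp only: comm[OF a x] m_assoc)
      finally show "a \<otimes> b \<otimes> x = x \<otimes> (a \<otimes> b)" .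
    qed (simp add: c)
  qed
  moreover have "x \<otimes> h \<otimes> inv x = h" if "x \<in> carrier G" "h \<in> center G" for x h
    using that(1) closed[OF that(2)] by (simp add: comm[OF that(2,1), symmetric] m_assoc)
  ultimately show ?thesis by (simp add: normal_inv_iff)
qed

lemma group_PSL: "group (PSL :: ('a::field ^ 'n ^ 'n) set monoid)"
  unfolding PSL_def by (intro normal.factorgroup_is_group group.center_normal group_SL)

text \<open>Groups act on the right: \<open>act x g\<close> is \<open>x\<^sup>g\<close>.\<close>

locale finite_right_action = group G for G (structure) +
  fixes \<Omega> :: "'x set" and act :: "'x \<Rightarrow> 'a \<Rightarrow> 'x"
  assumes finite_domain: "finite \<Omega>"
    and act_closed: "\<lbrakk>x \<in> \<Omega>; g \<in> carrier G\<rbrakk> \<Longrightarrow> act x g \<in> \<Omega>"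
    and act_one: "x \<in> \<Omega> \<Longrightarrow> act x \<one> = x"
    and act_mult: "\<lbrakk>x \<in> \<Omega>; g \<in> carrier G; h \<in> carrier G\<rbrakk> \<Longrightarrow> act x (g \<otimes> h) = act (act x g) h"

definition induced_perms :: "('g, 'm) monoid_scheme \<Rightarrow> 'x set \<Rightarrow> ('x \<Rightarrow> 'g \<Rightarrow> 'x) \<Rightarrow> ('x \<Rightarrow> 'x) set" where
  "induced_perms G \<Omega> act = (\<lambda>g. \<lambda>x\<in>\<Omega>. act x g) ` carrier G"

text \<open>Maps \<open>\<Omega> \<rightarrow> \<Omega>\<close> are represented extensionally, i.e. as elements of \<open>\<Omega> \<rightarrow>\<^sub>E \<Omega>\<close>.\<close>

inductive_set transf_semigroup :: "'x set \<Rightarrow> ('x \<Rightarrow> 'x) set \<Rightarrow> ('x \<Rightarrow> 'x) set"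
  for \<Omega> S where
  generator: "f \<in> S \<Longrightarrow> f \<in> transf_semigroup \<Omega> S"
| composition: "\<lbrakk>f \<in> transf_semigroup \<Omega> S; g \<in> transf_semigroup \<Omega> S\<rbrakk>
    \<Longrightarrow> compose \<Omega> f g \<in> transf_semigroup \<Omega> S"

text \<open>Only meaningful under \<^locale>\<open>finite_right_action\<close>, which is not part of the definition.\<close>

definition synchronising :: "('g, 'm) monoid_scheme \<Rightarrow> 'x set \<Rightarrow> ('x \<Rightarrow> 'g \<Rightarrow> 'x) \<Rightarrow> bool" where
  "synchronising G \<Omega> act \<longleftrightarrow>
    (\<forall>f \<in> \<Omega> \<rightarrow>\<^sub>E \<Omega>. \<not> bij_betw f \<Omega> \<Omega> \<longrightarrow>
      (\<exists>c \<in> \<Omega>. (\<lambda>x\<in>\<Omega>. c) \<in> transf_semigroup \<Omega> (insert f (induced_perms G \<Omega> act))))"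

definition diagonal_action :: "('t, 'm) monoid_scheme \<Rightarrow> 't \<Rightarrow> 't \<times> 't \<Rightarrow> 't" where
  "diagonal_action T t = (\<lambda>(x, y). inv\<^bsub>T\<^esub> x \<otimes>\<^bsub>T\<^esub> t \<otimes>\<^bsub>T\<^esub> y)"

lemma (in group) diagonal_finite_right_action:
  assumes "finite (carrier G)"
  shows "finite_right_action (G \<times>\<times> G) (carrier G) (diagonal_action G)"
proof -
  interpret GG: group "G \<times>\<times> G" by (intro DirProd_group is_group)
  show ?thesis
    by unfold_locales (use assms in \<open>auto simp: diagonal_action_def inv_mult_group m_assoc\<close>)
qed

lemma PSL_diagonal_finite_right_action:
  fixes T :: "('a::{field,finite} ^ 'n ^ 'n) set monoid"
  assumes "T = PSL"
  shows "finite_right_action (T \<times>\<times> T) (carrier T) (diagonal_action T)"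
  unfolding assms by (rule group.diagonal_finite_right_action[OF group_PSL]) simp

end

theory Submission
  imports Defs
begin

text \<open>Let \<open>T\<close> act on a set \<open>X\<close> of six objects, and suppose that \<open>K \<subseteq> T\<close> is sharply transitive on \<open>X\<close>.
  Join \<open>t, s \<in> T\<close> by an edge if \<open>x t \<noteq> x s\<close> for all \<open>x \<in> X\<close>. The diagonal action preserves
  this graph, \<open>K\<close> is a 6-clique, and \<open>t \<mapsto> x\<^sub>0 t\<close> is a 6-colouring, so sending \<open>t\<close> to the element
  \<open>k \<in> K\<close> with \<open>x\<^sub>0 k = x\<^sub>0 t\<close> is a non-injective endomorphism of the graph; no composite of
  endomorphisms is constant.

  The six objects come from the isomorphism of \<open>PSL(2,9)\<close> with the alternating group \<open>A\<^sub>6\<close>. They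
  are realised as functions \<open>f\<close> on \<open>F\<^sub>9\<^sup>2\<close> with \<open>f(c v) = c^4 f(v)\<close>, permuted by the substitutions in
  \<open>SL(2,9)\<close>. A Borel subgroup splits them into two blocks of three. Translations by \<open>F\<^sub>3\<close> rotate both
  blocks and a diagonal matrix of order 8 swaps them, so these translations and their products
  with that matrix form \<open>K\<close>.\<close>

section \<open>Finite fields: characteristic and Frobenius\<close>

lemma of_nat_CARD: "of_nat CARD('a::{ring_1,finite}) = (0::'a)"
proof -
  have "(\<Sum>x\<in>UNIV. x + 1) = (\<Sum>x\<in>UNIV. x::'a)"
    by (rule sum.reindex_bij_witness[of _ "\<lambda>x. x - 1" "\<lambda>x. x + 1"]) auto
  thus ?thesis by (simp add: sum.distrib)
qed

lemma power_CARD_eq: "x ^ CARD('a) = (x::'a::{field,finite})"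
proof (cases "x = 0")
  case False
  let ?S = "UNIV - {0::'a}"
  have "(\<Prod>y\<in>?S. x * y) = (\<Prod>y\<in>?S. y)"
    by (rule prod.reindex_bij_witness[of _ "\<lambda>y. y / x" "\<lambda>y. x * y"]) (use False in auto)
  hence "x ^ card ?S = 1" by (simp add: prod.distrib)
  moreover have "CARD('a) = Suc (card ?S)" by (rule card.remove) simp_all
  ultimately show ?thesis by (simp only: power_Suc mult_1_right)
qed simp

section \<open>Graph endomorphisms as an obstruction to synchronisation\<close>

text \<open>The generators, hence all their composites, preserve edges, so a constant map would turn
  the edge from \<open>a\<close> to \<open>b\<close> into a loop.\<close>

lemma not_synchronisingI:
  assumes f: "f \<in> \<Omega> \<rightarrow>\<^sub>E \<Omega>" "\<not> inj_on f \<Omega>"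
    and act_closed: "\<And>x g. \<lbrakk>x \<in> \<Omega>; g \<in> carrier G\<rbrakk> \<Longrightarrow> act x g \<in> \<Omega>"
    and adj_act: "\<And>x y g. \<lbrakk>x \<in> \<Omega>; y \<in> \<Omega>; g \<in> carrier G; adj x y\<rbrakk> \<Longrightarrow> adj (act x g) (act y g)"
    and adj_f: "\<And>x y. \<lbrakk>x \<in> \<Omega>; y \<in> \<Omega>; adj x y\<rbrakk> \<Longrightarrow> adj (f x) (f y)"
    and irrefl: "\<And>x. x \<in> \<Omega> \<Longrightarrow> \<not> adj x x"
    and edge: "a \<in> \<Omega>" "b \<in> \<Omega>" "adj a b"
  shows "\<not> synchronising G \<Omega> act"
proof
  assume "synchronising G \<Omega> act"
  then obtain c where c: "c \<in> \<Omega>"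
    "(\<lambda>x\<in>\<Omega>. c) \<in> transf_semigroup \<Omega> (insert f (induced_perms G \<Omega> act))"
    using f unfolding synchronising_def bij_betw_def by blast
  have "(\<forall>x\<in>\<Omega>. h x \<in> \<Omega>) \<and> (\<forall>x\<in>\<Omega>. \<forall>y\<in>\<Omega>. adj x y \<longrightarrow> adj (h x) (h y))"
    if "h \<in> transf_semigroup \<Omega> (insert f (induced_perms G \<Omega> act))" for h
    using that
  proof induction
    case (generator h)
    then show ?case
      using f(1) act_closed adj_act adj_f by (auto simp: induced_perms_def)
  next
    case (composition g h)
    then show ?case by (auto simp: compose_def)
  qed
  from this[OF c(2)] have "adj c c" using edge by auto
  with irrefl c(1) show False by blast
qed

section \<open>Generators and centre of SL(2), and cosets of the centre\<close>

definition mat2 :: "'a \<Rightarrow> 'a \<Rightarrow> 'a \<Rightarrow> 'a \<Rightarrow> 'a::zero ^ 2 ^ 2" where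
  "mat2 a b c d = vector [vector [a, b], vector [c, d]]"

lemma mat2_nth [simp]:
  "mat2 a b c d $ 1 $ 1 = a" "mat2 a b c d $ 1 $ 2 = b"
  "mat2 a b c d $ 2 $ 1 = c" "mat2 a b c d $ 2 $ 2 = d"
  by (simp_all add: mat2_def)

lemma mat2_eq_iff [simp]:
  "mat2 a b c d = mat2 a' b' c' d' \<longleftrightarrow> a = a' \<and> b = b' \<and> c = c' \<and> d = d'"
  by (auto simp: vec_eq_iff forall_2)

lemma mat2_cases [cases type]:
  obtains a b c d where "A = mat2 a b c d"
proof
  show "A = mat2 (A$1$1) (A$1$2) (A$2$1) (A$2$2)" by (simp add: vec_eq_iff forall_2)
qed

lemma mat2_mult:
  "mat2 a b c d ** mat2 a' b' c' d' =
    mat2 (a*a' + b*c') (a*b' + b*d') (c*a' + d*c') (c*b' + d*d')"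
  for a :: "'a::semiring_1"
  by (simp add: vec_eq_iff forall_2 matrix_matrix_mult_def sum_2)

lemma mat2_mult_vector:
  fixes v :: "'a::semiring_1 ^ 2"
  shows "(mat2 a b c d *v v) $ 1 = a * v$1 + b * v$2" "(mat2 a b c d *v v) $ 2 = c * v$1 + d * v$2"
  by (simp_all add: matrix_vector_mult_def sum_2)

lemma mat2_in_SL: "mat2 a b c d \<in> carrier SL \<longleftrightarrow> a * d - b * c = 1"
  by (simp add: SL_def det_2)

lemma SL_mult: "A \<otimes>\<^bsub>SL\<^esub> B = A ** B"
  by (simp add: SL_def)

text \<open>Reduces invariance under SL(2) to two kinds of substitution. Only products are
  available, so inverses are written as positive words.\<close>

lemma SL2_induct [consumes 1, case_names transvection rotation mult]:
  fixes A :: "'a::field ^ 2 ^ 2"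
  assumes "A \<in> carrier SL"
    and transvection: "\<And>b. P (mat2 1 b 0 1)"
    and rotation: "P (mat2 0 1 (-1) 0)"
    and mult: "\<And>A B. P A \<Longrightarrow> P B \<Longrightarrow> P (A ** B)"
  shows "P A"
proof -
  let ?w = "mat2 0 1 (-1) 0 :: 'a ^ 2 ^ 2"
  \<comment> \<open>The fourth power of \<open>?w\<close> is the identity, so its cube is its
    inverse and this is a conjugate of an upper transvection.\<close>
  have "P (?w ** (mat2 1 (-c) 0 1 ** (?w ** (?w ** ?w))))" for c
    by (intro mult rotation transvection)
  then have lower: "P (mat2 1 0 c 1)" for c by (simp add: mat2_mult)
  have *: "P (mat2 a b c d)" if "a * d - b * c = 1" "c \<noteq> 0" for a b c d
  proof -
    \<comment> \<open>The outer entries are forced by the diagonal \<open>a\<close>,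
      \<open>d\<close>; the determinant then yields \<open>b\<close>.\<close>
    have "P (mat2 1 ((a - 1) / c) 0 1 ** (mat2 1 0 c 1 ** mat2 1 ((d - 1) / c) 0 1))"
      by (intro mult lower transvection)
    moreover have "(d - 1) / c + (a - 1) / c * d = b" using that by (simp add: field_simps)
    ultimately show ?thesis using that by (simp add: mat2_mult)
  qed
  obtain a b c d where A: "A = mat2 a b c d" by (cases A)
  with assms(1) have det: "a * d - b * c = 1" by (simp add: mat2_in_SL)
  show ?thesis
  proof (cases "c = 0")
    case True
    \<comment> \<open>Here \<open>a\<close> is nonzero. The last factor is \<open>?w ** A\<close>,
      whose lower left entry \<open>-a\<close> makes \<open>*\<close> applicable; three more factors
      \<open>?w\<close> restore \<open>A\<close>.\<close>
    then have "P (mat2 0 1 (-1) 0 ** (?w ** (?w ** mat2 c d (-a) (-b))))"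
      using det by (intro mult rotation *) (auto simp: mult.commute)
    then show ?thesis by (simp add: A mat2_mult)
  qed (use * det A in blast)
qed

lemma center_SL2:
  assumes "z \<in> center (SL :: ('a::field ^ 2 ^ 2) monoid)"
  obtains a where "z = mat2 a 0 0 a" "a^2 = 1"
proof -
  obtain a b c d where z: "z = mat2 a b c d" by (cases z)
  have comm: "z ** x = x ** z" if "x \<in> carrier SL" for x
    using assms that by (simp add: center_def SL_mult)
  have "c = 0" "a = d" using comm[of "mat2 1 1 0 1"] by (auto simp: z mat2_mult mat2_in_SL)
  moreover have "b = 0" using comm[of "mat2 1 0 1 1"] by (auto simp: z mat2_mult mat2_in_SL)
  moreover have "z \<in> carrier SL" using assms by (simp add: center_def)
  ultimately show thesis using that[of a] by (simp add: z mat2_in_SL power2_eq_square)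
qed

lemma PSL_carrier: "carrier PSL = (\<lambda>A. center SL #>\<^bsub>SL\<^esub> A) ` carrier SL"
  by (auto simp: PSL_def FactGroup_def RCOSETS_def)

lemma mem_SL_coset: "A \<in> center SL #>\<^bsub>SL\<^esub> B \<longleftrightarrow> (\<exists>z\<in>center SL. A = z ** B)"
  by (auto simp: r_coset_def SL_mult)

lemma SL_coset_self: "A \<in> center SL #>\<^bsub>SL\<^esub> A"
proof -
  have "mat 1 \<in> center SL" by (simp add: center_def SL_def)
  then show ?thesis unfolding mem_SL_coset by force
qed

lemma PSL_mem_SL:
  assumes "t \<in> carrier PSL" "A \<in> t"
  shows "A \<in> carrier SL"
proof -
  obtain z B where "A = z ** B" "z \<in> center SL" "B \<in> carrier SL"
    using assms by (auto simp: PSL_carrier mem_SL_coset)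
  then show ?thesis by (simp add: center_def SL_def det_mul)
qed

lemma mem_PSL_mult: "A \<in> s \<otimes>\<^bsub>PSL\<^esub> t \<longleftrightarrow> (\<exists>B\<in>s. \<exists>C\<in>t. A = B ** C)"
  by (auto simp: PSL_def FactGroup_def set_mult_def SL_mult)

section \<open>Arithmetic of F_9 = F_3(i) and the six functions\<close>

locale field_9 =
  fixes i :: "'q::field"
  assumes i2: "i^2 = -1"
    and three: "(3::'q) = 0"
    and pow9: "x^9 = (x::'q)"
begin

text \<open>With the norm \<open>N y = y^4\<close> and the two linear functionals \<open>shift e\<close> from \<open>F\<^sub>9\<close> to \<open>F\<^sub>3\<close>, this
  polynomial is \<open>e N(y) (1 + (k + shift e (x/y))\<^sup>2)\<close> if \<open>y\<close> is nonzero, and \<open>e N(x)\<close> otherwise.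
  The sign \<open>e\<close> is the block and \<open>k \<in> F\<^sub>3\<close> the position in it; \<open>x^3\<close> is the conjugate of \<open>x\<close>.\<close>

definition form :: "'q \<Rightarrow> 'q \<Rightarrow> 'q \<Rightarrow> 'q \<Rightarrow> 'q" where
  "form e k x y = e * (x * x^3 + (1 + k^2) * (y * y^3) + k * ((1 - e*i) * (x * y^3) + (1 + e*i) * (x^3 * y)))
     + i * (x^2 * y^2 - (x^3)^2 * (y^3)^2)"

definition shift :: "'q \<Rightarrow> 'q \<Rightarrow> 'q" where
  "shift e b = e*i * (b - b^3) - (b + b^3)"

text \<open>Here 2 = -1. As in the computations below, characteristic 3 enters through an explicit
  multiple of 3 in an integral identity.\<close>

lemma square_add: "(x + y)^2 = x^2 - x*y + (y::'q)^2"
proof -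
  have "(x + y)^2 = x^2 - x*y + y^2 + 3 * (x*y)" by algebra
  thus ?thesis by (simp add: three)
qed

lemma cube_add: "(x + y)^3 = x^3 + (y::'q)^3"
proof -
  have "(x + y)^3 = x^3 + y^3 + 3 * (x*y*(x+y))" by algebra
  thus ?thesis by (simp add: three)
qed

lemma cube_cube: "(x^3)^3 = (x::'q)"
  using pow9[of x] by (simp add: power_mult[symmetric])

lemma shift_square:
  assumes "e^2 = 1"
  shows "shift e b ^ 2 = b * b^3 + e*i * (b^2 - (b^3)^2)"
proof -
  have "shift e b ^ 2 = b * b^3 + e*i * (b^2 - (b^3)^2) + 3 * (b * b^3 - e*i * (b^2 - (b^3)^2))"
    using assms i2 unfolding shift_def by algebra
  thus ?thesis by (simp add: three)
qed

lemma shift_mult: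
  assumes "e^2 = 1"
  shows "(1 - e*i) * shift e b = b^3 - e*i*b" and "(1 + e*i) * shift e b = b + e*i*b^3"
proof -
  have "(1 - e*i) * shift e b = b^3 - e*i*b + 3 * (e*i*b - b^3)"
    and "(1 + e*i) * shift e b = b + e*i*b^3 - 3 * (b + e*i*b^3)"
    using assms i2 unfolding shift_def by algebra+
  thus "(1 - e*i) * shift e b = b^3 - e*i*b" and "(1 + e*i) * shift e b = b + e*i*b^3"
    by (simp_all add: three)
qed

text \<open>For nonzero \<open>y\<close> this reflects additivity of \<open>shift e\<close> at
  \<open>x/y + b\<close>; the polynomial proof covers \<open>y = 0\<close> as well.\<close>

lemma form_transvection:
  assumes "e^2 = 1"
  shows "form e k (x + b*y) y = form e (k + shift e b) x y"
proof -
  \<comment> \<open>Conjugates become separate variables, linked to the originals only by the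
    relations stated next.\<close>
  define X Y B t where "X = x^3" and "Y = y^3" and "B = b^3" and "t = shift e b"
  have Y: "y^3 = Y" "Y^3 = y" by (simp_all add: Y_def pow9)
  have t: "t = e*i * (b - B) - (b + B)" "t^2 = b*B + e*i * (b^2 - B^2)" 
     "(1 - e*i) * t = B - e*i*b" "(1 + e*i) * t = b + e*i*B"
    using shift_square[OF assms] shift_mult[OF assms] by (simp_all add: shift_def t_def B_def)
  let ?L = "e * ((x + b*y) * (X + B*Y) + (1 + k^2) * (y * Y)
       + k * ((1 - e*i) * ((x + b*y) * Y) + (1 + e*i) * ((X + B*Y) * y)))
     + i * ((x^2 - x*(b*y) + (b*y)^2) * y^2 - (X^2 - X*(B*Y) + (B*Y)^2) * Y^2)"
  let ?R = "e * (x * X + (1 + (k^2 - k * t + t^2)) * (y * Y)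
       + (k + t) * ((1 - e*i) * (x * Y) + (1 + e*i) * (X * y)))
     + i * (x^2 * y^2 - X^2 * Y^2)"
  have "(x + b*y)^3 = X + B*Y" by (simp add: cube_add power_mult_distrib X_def Y_def B_def)
  then have L: "form e k (x + b*y) y = ?L"
    unfolding form_def Y by (simp only: square_add)
  have R: "form e (k + t) x y = ?R"
    unfolding form_def square_add[of k] X_def Y_def ..
  \<comment> \<open>Each summand has a factor that vanishes by the formulas for \<open>t\<close> or
    by \<open>y^3 = Y\<close> and \<open>Y^3 = y\<close>.\<close>
  have "?L - ?R = e * k * (y * Y) * (b * (1 - e*i) + B * (1 + e*i) + t)
       - (e * ((1 - e*i) * t) - (e * B - i * b)) * (x * Y)
       - (e * ((1 + e*i) * t) - (e * b + i * B)) * (X * y)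
       - (e * t^2 - (e * (b * B) + i * (b^2 - B^2))) * (y * Y)
       + i * (b * (b * y - x) * (y^3 - Y) + B * (X - B * Y) * (Y^3 - y))"
    by (simp add: algebra_simps power2_eq_square power3_eq_cube)
  moreover have "b * (1 - e*i) + B * (1 + e*i) + t = 0"
    unfolding t(1) by (simp add: algebra_simps)
  moreover have "e * ((1 - e*i) * t) = e * B - i * b" 
    unfolding t(3) using assms by algebra
  moreover have "e * ((1 + e*i) * t) = e * b + i * B"
    unfolding t(4) using assms by algebra
  moreover have "e * t^2 = e * (b * B) + i * (b^2 - B^2)"
    unfolding t(2) using assms by algebra
  ultimately have "?L - ?R = 0" by (simp only: Y diff_self mult_zero_left mult_zero_right diff_zero add_0_right)
  then show ?thesis unfolding L t_def[symmetric] R by (simp only: right_minus_eq)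
qed

text \<open>The rotation fixes the two functions with \<open>k = 0\<close>; on the other four it
  swaps the blocks, because \<open>1 + k^2 = -1\<close> there.\<close>

lemma form_rotation_0: "form e 0 y (-x) = form e 0 x y"
  unfolding form_def by (simp add: algebra_simps)

lemma form_rotation:
  assumes "k^2 = 1"
  shows "form e k y (-x) = form (-e) k x y"
proof -
  have "form e k y (-x) - form (-e) k x y = 3 * (e * (x*x^3 + y*y^3))"
    unfolding form_def assms by (simp add: algebra_simps)
  thus ?thesis by (simp add: three)
qed

text \<open>The norm of \<open>1 - i\<close> is \<open>(1 - i) * (1 + i) = -1\<close>, which flips
  the block; \<open>-(1 + i)\<close> is the inverse of \<open>1 - i\<close>.\<close>

lemma form_diagonal:
  assumes "e^2 = 1"
  shows "form e k ((1 - i) * x) (-(1 + i) * y) = form (-e) (e*k) x y"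
proof -
  have "i^3 = -i" using i2 by algebra
  then have cubes: "((1-i)*x)^3 = (1 + i) * x^3" "(-(1+i)*y)^3 = (i-1)*y^3"
    using cube_add[of 1 "-i"] cube_add[of "-1" "-i"] by (simp_all add: power_mult_distrib)
  have "(1-i)^2 = i - 3*i" "(1+i)^2 = 3*i - i" "(1-i)*(1+i) = 3 - 1"
    using i2 by algebra+
  then have sq: "(1-i)^2 = i" "(1+i)^2 = -i" "(1-i)*(1+i) = -1"
    by (simp_all add: three)
  define X Y where "X = x^3" and "Y = y^3"
  have xX: "((1 - i) * x) * ((1 + i) * X) = ((1 - i) * (1 + i)) * (x * X)"
    "(-(1 + i) * y) * ((i - 1) * Y) = ((1 - i) * (1 + i)) * (y * Y)"
    "((1 - i) * x) * ((i - 1) * Y) = -((1 - i)^2) * (x * Y)"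
    "((1 + i) * X) * (-(1 + i) * y) = -((1 + i)^2) * (X * y)"
    "((1 - i) * x)^2 * (-(1 + i) * y)^2 = ((1 - i) * (1 + i))^2 * (x^2 * y^2)"
    "((1 + i) * X)^2 * ((i - 1) * Y)^2 = ((1 - i) * (1 + i))^2 * (X^2 * Y^2)"
    by algebra+
  have k: "(1 + (e*k)^2) = 1 + k^2" using assms by algebra
  have "e * (- (x * X) + (1 + k^2) * (- (y * Y)) + k * ((1 - e*i) * (- i * (x * Y)) + (1 + e*i) * (i * (X * y))))
      = (-e) * (x * X + (1 + k^2) * (y * Y) + e * k * ((1 - (-e)*i) * (x * Y) + (1 + (-e)*i) * (X * y)))"
    using assms i2 by algebra
  then show ?thesis
    unfolding form_def cubes X_def[symmetric] Y_def[symmetric] xX sq k by simp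
qed

lemma form_center:
  assumes "a^2 = 1"
  shows "form e k (a*x) (a*y) = form e k x y"
proof -
  have "a = 1 \<or> a = -1" using assms by (simp add: power2_eq_1_iff)
  then show ?thesis by (auto simp: form_def)
qed

section \<open>The permutation action on the six functions\<close>

definition Form :: "'q \<Rightarrow> 'q \<Rightarrow> 'q ^ 2 \<Rightarrow> 'q" where
  "Form e k v = form e k (v$1) (v$2)"

text \<open>\<open>k^3 = k\<close> is the equation of the prime field F_3.\<close>

definition forms :: "('q ^ 2 \<Rightarrow> 'q) set" where
  "forms = {Form e k | e k. e^2 = 1 \<and> k^3 = k}"

lemma Form_transvection:
  "e^2 = 1 \<Longrightarrow> Form e k \<circ> (*v) (mat2 1 b 0 1) = Form e (k + shift e b)"
  by (simp add: fun_eq_iff Form_def mat2_mult_vector form_transvection)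

text \<open>The values at (1,0), (0,1) and (1,1) recover \<open>e\<close>, \<open>k^2\<close> and
  \<open>2 * k = -k\<close> in turn.\<close>

lemma Form_inject:
  assumes "Form e k = Form e' k'" "e^2 = 1"
  shows "e = e'" "k = k'"
proof -
  have eq: "form e k x y = form e' k' x y" for x y
    using fun_cong[OF assms(1), of "vector [x, y]"] by (simp add: Form_def)
  show e: "e = e'" using eq[of 1 0] by (simp add: form_def)
  have "e \<noteq> 0" using assms(2) by auto
  then have "k^2 = k'^2" using eq[of 0 1] by (simp add: form_def e)
  with \<open>e \<noteq> 0\<close> have "k * 2 = k' * 2" using eq[of 1 1] by (simp add: form_def e del: mult_cancel_right)
  then have "3 * k - k * 2 = 3 * k' - k' * 2" by (simp add: three)
  then show "k = k'" by (simp add: algebra_simps)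
qed

lemma shift_cube_fixed: "shift e k = k" if "k^3 = k"
proof -
  have "shift e k = k - 3 * k" using that by (simp add: shift_def)
  then show ?thesis by (simp add: three)
qed

text \<open>Since the values lie in F_3, transvections keep \<open>k\<close> in F_3.\<close>

lemma cube_shift: "(shift e b)^3 = shift e b" if "e^2 = 1"
proof -
  have "e = 1 \<or> e = -1" using that by (simp add: power2_eq_1_iff)
  then have e: "e^3 = e" by auto
  have i3: "i^3 = -i" using i2 by algebra
  have minus: "(x - y)^3 = x^3 - y^3" for x y :: 'q using cube_add[of x "-y"] by simp
  show ?thesis
    unfolding shift_def minus cube_add power_mult_distrib cube_cube e i3 by (simp add: algebra_simps)
qed

lemma forms_closed:
  assumes "A \<in> carrier SL" "\<phi> \<in> forms"
  shows "\<phi> \<circ> (*v) A \<in> forms"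
  using assms
proof (induction arbitrary: \<phi> rule: SL2_induct)
  case (transvection b)
  then obtain e k where "\<phi> = Form e k" "e^2 = 1" "k^3 = k" by (auto simp: forms_def)
  moreover from this have "(k + shift e b)^3 = k + shift e b"
    by (simp add: cube_add cube_shift)
  ultimately show ?case by (auto simp: forms_def Form_transvection)
next
  case rotation
  then obtain e k where \<phi>: "\<phi> = Form e k" "e^2 = 1" "k^3 = k" by (auto simp: forms_def)
  have "k * (k^2 - 1) = 0" using \<phi>(3) by (simp add: algebra_simps power2_eq_square power3_eq_cube)
  then consider "k = 0" | "k^2 = 1" by auto
  then show ?case
  proof cases
    case 1
    then have "\<phi> \<circ> (*v) (mat2 0 1 (-1) 0) = \<phi>"
      by (simp add: \<phi> fun_eq_iff Form_def mat2_mult_vector form_rotation_0)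
    with rotation show ?thesis by simp
  next
    case 2
    then have "\<phi> \<circ> (*v) (mat2 0 1 (-1) 0) = Form (-e) k"
      by (simp add: \<phi> fun_eq_iff Form_def mat2_mult_vector form_rotation)
    moreover have "(-e)^2 = 1" using \<phi> by simp
    ultimately show ?thesis using \<phi>(3) unfolding forms_def by blast
  qed
next
  case (mult A B)
  then have "(\<phi> \<circ> (*v) A) \<circ> (*v) B \<in> forms" by blast
  then show ?case by (simp add: o_def matrix_vector_mul_assoc)
qed

text \<open>The centre consists of scalars 1 and -1 and the six functions are even, so the action
  descends to PSL.\<close>

lemma forms_coset:
  assumes "\<phi> \<in> forms" "t \<in> carrier PSL" "A \<in> t" "B \<in> t"
  shows "\<phi> \<circ> (*v) A = \<phi> \<circ> (*v) B"
proof -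
  obtain C where C: "t = center SL #>\<^bsub>SL\<^esub> C" using assms(2) by (auto simp: PSL_carrier)
  have "\<phi> \<circ> (*v) A = \<phi> \<circ> (*v) C" if "A \<in> t" for A
  proof -
    obtain z where z: "z \<in> center SL" "A = z ** C" using \<open>A \<in> t\<close> unfolding C mem_SL_coset by blast
    obtain a where a: "z = mat2 a 0 0 a" "a^2 = 1" using center_SL2[OF z(1)] .
    have "\<phi> (z *v v) = \<phi> v" for v
      using assms(1) a by (auto simp: forms_def Form_def mat2_mult_vector form_center)
    then show ?thesis by (simp add: z(2) fun_eq_iff flip: matrix_vector_mul_assoc)
  qed
  with assms(3,4) show ?thesis by simp
qed

section \<open>The invariant graph, its clique and its colouring\<close>

text \<open>Quantifying over all representatives avoids choosing one; by \<open>forms_coset\<close>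
  any single pair decides.\<close>

definition adj :: "('q ^ 2 ^ 2) set \<Rightarrow> ('q ^ 2 ^ 2) set \<Rightarrow> bool" where
  "adj t s \<longleftrightarrow> (\<forall>A\<in>t. \<forall>B\<in>s. \<forall>\<phi>\<in>forms. \<phi> \<circ> (*v) A \<noteq> \<phi> \<circ> (*v) B)"

text \<open>The left factor only replaces one of the six functions by another, and the right factor
  can be cancelled.\<close>

lemma adj_diagonal_action:
  assumes "t \<in> carrier PSL" "s \<in> carrier PSL" "g \<in> carrier (PSL \<times>\<times> PSL)" "adj t s"
  shows "adj (diagonal_action PSL t g) (diagonal_action PSL s g)"
proof -
  obtain x y where g: "g = (x, y)" "x \<in> carrier PSL" "y \<in> carrier PSL"
    using assms(3) by auto
  define x' where "x' = inv\<^bsub>PSL\<^esub> x"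
  have x': "x' \<in> carrier PSL" unfolding x'_def using group.inv_closed[OF group_PSL g(2)] .
  show ?thesis unfolding adj_def
  proof (intro ballI notI)
    fix A B \<phi>
    assume "A \<in> diagonal_action PSL t g" "B \<in> diagonal_action PSL s g"
      and \<phi>: "\<phi> \<in> forms" and eq: "\<phi> \<circ> (*v) A = \<phi> \<circ> (*v) B"
    then obtain A1 A2 A3 B1 B2 B3 where AB: "A1 \<in> x'" "A2 \<in> t" "A3 \<in> y" "A = A1 ** A2 ** A3"
      "B1 \<in> x'" "B2 \<in> s" "B3 \<in> y" "B = B1 ** B2 ** B3"
      by (auto simp: diagonal_action_def g(1) mem_PSL_mult x'_def)
    have SL: "A1 \<in> carrier SL" "A2 \<in> carrier SL" "A3 \<in> carrier SL" "B2 \<in> carrier SL"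
      using AB PSL_mem_SL assms(1,2) g x' by blast+
    define \<psi> where "\<psi> = \<phi> \<circ> (*v) A1"
    have \<psi>: "\<psi> \<in> forms" "\<psi> = \<phi> \<circ> (*v) B1"
      unfolding \<psi>_def using forms_closed[OF SL(1) \<phi>] forms_coset[OF \<phi> x' AB(1,5)] by auto
    have "\<psi> \<circ> (*v) A2 \<circ> (*v) A3 = \<phi> \<circ> (*v) A"
      by (simp add: \<psi>_def AB o_def matrix_vector_mul_assoc)
    also have "\<dots> = \<psi> \<circ> (*v) B2 \<circ> (*v) B3"
      unfolding eq by (simp add: \<psi>(2) AB o_def matrix_vector_mul_assoc)
    \<comment> \<open>Both sides must end in the same representative of \<open>y\<close> before it
      can be cancelled.\<close>
    also have "\<dots> = \<psi> \<circ> (*v) B2 \<circ> (*v) A3"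
      using forms_coset[OF forms_closed[OF SL(4) \<psi>(1)] g(3) AB(7,3)] .
    finally have "\<psi> (A2 *v (A3 *v v)) = \<psi> (B2 *v (A3 *v v))" for v
      by (simp add: fun_eq_iff)
    moreover obtain D where "A3 ** D = mat 1"
      using SL(3) invertible_det_nz[of A3] by (auto simp: SL_def invertible_def)
    then have "v = A3 *v (D *v v)" for v by (simp add: matrix_vector_mul_assoc)
    ultimately have "\<psi> \<circ> (*v) A2 = \<psi> \<circ> (*v) B2" by (metis comp_apply ext)
    with assms(4) AB \<psi>(1) show False by (auto simp: adj_def)
  qed
qed

text \<open>Indexed so that \<open>clique e k\<close> carries \<open>Form 1 0\<close> to
  \<open>Form e k\<close> for the admissible pairs.\<close>

definition clique :: "'q \<Rightarrow> 'q \<Rightarrow> 'q ^ 2 ^ 2" where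
  "clique e k = (if e = 1 then mat2 1 k 0 1 else mat2 1 k 0 1 ** mat2 (1 - i) 0 0 (-(1 + i)))"

lemma clique_in_SL: "clique e k \<in> carrier SL"
proof -
  have "(1 - i) * (- 1 - i) = 1 - 3" using i2 by algebra
  then show ?thesis by (simp add: clique_def mat2_mult mat2_in_SL three)
qed

lemma Form_clique:
  assumes "e^2 = 1" "e'^2 = 1" "k'^3 = k'"
  shows "Form e k \<circ> (*v) (clique e' k') = Form (e * e') (if e' = 1 then k + k' else e * (k + k'))"
proof -
  have "Form e k \<circ> (*v) (mat2 1 k' 0 1) = Form e (k + k')"
    using assms by (simp add: Form_transvection shift_cube_fixed)
  moreover have "Form e (k + k') \<circ> (*v) (mat2 (1 - i) 0 0 (-(1 + i))) = Form (-e) (e * (k + k'))"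
    using form_diagonal[OF assms(1)] by (simp add: fun_eq_iff Form_def mat2_mult_vector)
  moreover have "e' = -1" if "e' \<noteq> 1" using assms(2) that by (simp add: power2_eq_1_iff)
  ultimately show ?thesis
    by (auto simp: clique_def fun_eq_iff simp flip: matrix_vector_mul_assoc)
qed

abbreviation coset :: "'q ^ 2 ^ 2 \<Rightarrow> ('q ^ 2 ^ 2) set" where
  "coset A \<equiv> center SL #>\<^bsub>SL\<^esub> A"

text \<open>As \<open>e0\<close> is nonzero, the image of \<open>Form e0 k0\<close> determines first
  \<open>e\<close> and then \<open>k\<close>.\<close>

lemma adj_clique:
  assumes "e^2 = 1" "k^3 = k" "e'^2 = 1" "k'^3 = k'" "(e, k) \<noteq> (e', k')"
  shows "adj (coset (clique e k)) (coset (clique e' k'))"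
  unfolding adj_def
proof (intro ballI notI)
  fix A B \<phi>
  assume A: "A \<in> coset (clique e k)" and B: "B \<in> coset (clique e' k')"
    and \<phi>: "\<phi> \<in> forms" and eq: "\<phi> \<circ> (*v) A = \<phi> \<circ> (*v) B"
  obtain e0 k0 where \<phi>': "\<phi> = Form e0 k0" "e0^2 = 1" using \<phi> by (auto simp: forms_def)
  have C: "coset (clique e k) \<in> carrier PSL" for e k
    by (auto simp: PSL_carrier clique_in_SL)
  have "\<phi> \<circ> (*v) (clique e k) = \<phi> \<circ> (*v) (clique e' k')"
    using forms_coset[OF \<phi> C A SL_coset_self] forms_coset[OF \<phi> C B SL_coset_self] eq by simp
  then have "Form (e0 * e) (if e = 1 then k0 + k else e0 * (k0 + k)) =
      Form (e0 * e') (if e' = 1 then k0 + k' else e0 * (k0 + k'))"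
    using assms \<phi>' by (simp add: Form_clique)
  note Form_inject[OF this]
  moreover have "(e0 * e)^2 = 1" "e0 \<noteq> 0" using assms \<phi>' by (auto simp: power_mult_distrib)
  ultimately have "e = e'" and "(if e = 1 then k0 + k else e0 * (k0 + k)) = (if e' = 1 then k0 + k' else e0 * (k0 + k'))"
    by simp_all
  then have "k = k'" using \<open>e0 \<noteq> 0\<close> by (cases "e = 1") simp_all
  with \<open>e = e'\<close> assms(5) show False by simp
qed

lemma two_neq_zero: "(2::'q) \<noteq> 0"
proof
  assume "(2::'q) = 0"
  then have "(3::'q) - 2 = 0" by (simp only: three) simp
  then show False by simp
qed

lemma not_synchronising_PSL2:
  "\<not> synchronising (PSL \<times>\<times> PSL) (carrier PSL) (diagonal_action (PSL :: ('q ^ 2 ^ 2) set monoid))"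
proof -
  let ?T = "PSL :: ('q ^ 2 ^ 2) set monoid"
  have base: "Form 1 0 \<in> forms"
    unfolding forms_def mem_Collect_eq by (intro exI[of _ 1] exI[of _ 0]) simp
  have coset: "coset A \<in> carrier PSL" if "A \<in> carrier SL" for A
    using that by (auto simp: PSL_carrier)
  \<comment> \<open>The pair is the colour of \<open>t\<close>: the index of the image of
    \<open>Form 1 0\<close>.\<close>
  have "\<forall>t\<in>carrier ?T. \<exists>p. (fst p)^2 = 1 \<and> (snd p)^3 = snd p \<and>
      (\<forall>A\<in>t. Form 1 0 \<circ> (*v) A = Form (fst p) (snd p))"
  proof
    fix t assume t: "t \<in> carrier ?T"
    then obtain A where A: "A \<in> t" "A \<in> carrier SL"
      using SL_coset_self by (auto simp: PSL_carrier)
    with forms_closed[OF A(2) base] obtain e k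
      where ek: "e^2 = 1" "k^3 = k" "Form 1 0 \<circ> (*v) A = Form e k" by (auto simp: forms_def)
    have "Form 1 0 \<circ> (*v) B = Form e k" if "B \<in> t" for B
      using forms_coset[OF base t that A(1)] ek(3) by simp
    with ek show "\<exists>p. (fst p)^2 = 1 \<and> (snd p)^3 = snd p \<and>
      (\<forall>A\<in>t. Form 1 0 \<circ> (*v) A = Form (fst p) (snd p))"
      by (intro exI[of _ "(e, k)"]) simp
  qed
  then obtain p where p: "\<And>t. t \<in> carrier ?T \<Longrightarrow> (fst (p t))^2 = 1"
      "\<And>t. t \<in> carrier ?T \<Longrightarrow> (snd (p t))^3 = snd (p t)"
      "\<And>t A. \<lbrakk>t \<in> carrier ?T; A \<in> t\<rbrakk> \<Longrightarrow> Form 1 0 \<circ> (*v) A = Form (fst (p t)) (snd (p t))"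
    by metis
  \<comment> \<open>Each \<open>t\<close> goes to the clique element of its own colour.\<close>
  define f where "f = (\<lambda>t\<in>carrier ?T. coset (clique (fst (p t)) (snd (p t))))"
  show ?thesis
  proof (rule not_synchronisingI[where f = f and adj = adj])
    show "f \<in> carrier ?T \<rightarrow>\<^sub>E carrier ?T"
      using clique_in_SL coset by (auto simp: f_def)
    show "\<not> inj_on f (carrier ?T)"
    proof
      assume inj: "inj_on f (carrier ?T)"
      \<comment> \<open>A nonzero element of the kernel of \<open>shift 1\<close>: its transvection
        has the colour of the identity but is not central.\<close>
      define b where "b = 1 - i"
      have "b \<noteq> 0" using i2 two_neq_zero by (auto simp: b_def)
      have "i^3 = -i" using i2 by algebra
      then have "b^3 = 1 + i" using cube_add[of 1 "-i"] by (simp add: b_def)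
      then have "shift 1 b = i * (b - (1 + i)) - (b + (1 + i))" by (simp add: shift_def)
      then have "shift 1 b = 0" using i2 unfolding b_def by algebra
      have 1: "mat2 1 c 0 1 \<in> carrier SL" for c :: 'q by (simp add: mat2_in_SL)
      have p_eq: "p (coset (mat2 1 c 0 1)) = (1, shift 1 c)" for c
      proof -
        have "Form (fst (p (coset (mat2 1 c 0 1)))) (snd (p (coset (mat2 1 c 0 1)))) = Form 1 (shift 1 c)"
          using p(3)[OF coset[OF 1] SL_coset_self] by (simp add: Form_transvection)
        from Form_inject[OF this p(1)[OF coset[OF 1]]] show ?thesis by (simp add: prod_eq_iff)
      qed
      have "p (coset (mat2 1 b 0 1)) = p (coset (mat2 1 0 0 1))"
        unfolding p_eq using \<open>shift 1 b = 0\<close> by (simp add: shift_def)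
      then have "f (coset (mat2 1 b 0 1)) = f (coset (mat2 1 0 0 1))"
        using coset[OF 1] by (simp add: f_def)
      then have "coset (mat2 1 b 0 1) = coset (mat2 1 0 0 1)"
        using inj coset[OF 1] by (auto dest: inj_onD)
      then obtain z where z: "z \<in> center SL" "mat2 1 b 0 1 = z ** mat2 1 0 0 1"
        using SL_coset_self[of "mat2 1 b 0 1"] by (auto simp: mem_SL_coset)
      obtain a where "z = mat2 a 0 0 a" using center_SL2[OF z(1)] .
      with z(2) \<open>b \<noteq> 0\<close> show False by (auto simp: mat2_mult)
    qed
    show "diagonal_action ?T t g \<in> carrier ?T" if tg: "t \<in> carrier ?T" "g \<in> carrier (?T \<times>\<times> ?T)" for t g
    proof -
      interpret T: group ?T by (rule group_PSL)
      obtain x y where "g = (x, y)" "x \<in> carrier ?T" "y \<in> carrier ?T" using tg(2) by auto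
      with tg(1) show ?thesis by (simp only: diagonal_action_def prod.case T.m_closed T.inv_closed)
    qed
    show "adj (f t) (f s)" if ts: "t \<in> carrier ?T" "s \<in> carrier ?T" "adj t s" for t s
    proof -
      obtain A B where AB: "A \<in> t" "B \<in> s"
        using ts(1,2) SL_coset_self by (auto simp: PSL_carrier)
      with ts(3) base have "Form 1 0 \<circ> (*v) A \<noteq> Form 1 0 \<circ> (*v) B" by (auto simp: adj_def)
      then have "p t \<noteq> p s" using p(3) ts AB by metis
      then show ?thesis using p ts by (auto simp: f_def prod_eq_iff intro!: adj_clique)
    qed
    show "\<not> adj t t" if "t \<in> carrier ?T" for t
      using that SL_coset_self base unfolding PSL_carrier adj_def by blast
    show "coset (clique 1 0) \<in> carrier ?T" "coset (clique 1 1) \<in> carrier ?T"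
      using clique_in_SL coset by auto
    show "adj (coset (clique 1 0)) (coset (clique 1 1))" by (rule adj_clique) auto
  qed (rule adj_diagonal_action)
qed

end

section \<open>Application to a field with nine elements\<close>

text \<open>Otherwise \<open>x^4 + 1\<close> and \<open>x^2 + 1\<close> never vanish, so
  \<open>x^8 = 1\<close> forces \<open>x^2 = 1\<close>, leaving at most three field
  elements.\<close>

lemma field_9_sqrt_minus_one:
  assumes "CARD('q::{field,finite}) = 9"
  obtains i :: "'q::{field,finite}" where "i^2 = -1"
proof (rule ccontr)
  assume no: "\<not> thesis"
  have "x \<in> {0, 1, -1}" for x :: 'q
  proof (cases "x = 0")
    case False
    have "x * (x^8 - 1) = x ^ CARD('q) - x" by (simp add: assms algebra_simps flip: power_Suc)
    then have "x * (x^8 - 1) = 0" by (simp add: power_CARD_eq)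
    moreover have "x * (x^8 - 1) = x * ((x^2)^2 + 1) * (x^2 + 1) * (x^2 - 1)"
      by (simp add: algebra_simps flip: power_mult power_add power_Suc power_Suc2)
    moreover have nonzero: "y^2 + 1 \<noteq> 0" for y :: 'q
      using no that by (auto simp: add_eq_0_iff2)
    moreover have "x^4 + 1 \<noteq> 0" using nonzero[of "x^2"] by (simp flip: power_mult)
    ultimately have "x^2 = 1" using False by auto
    then show ?thesis by (simp add: power2_eq_1_iff)
  qed simp
  then have "CARD('q) \<le> card {0, 1, -1 :: 'q}" by (intro card_mono) auto
  also have "\<dots> \<le> 3" by (simp add: card_insert_if)
  finally show False using assms by simp
qed

theorem proposition2p3:
  fixes T :: "('q::{field,finite} ^ 2 ^ 2) set monoid"
  assumes "CARD('q) = 9"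
    and "T = PSL"
  shows "\<not> synchronising (T \<times>\<times> T) (carrier T) (diagonal_action T)"
proof -
  obtain i :: 'q where "i^2 = -1" using field_9_sqrt_minus_one[OF assms(1)] .
  moreover have "(3::'q) * 3 = 0" using of_nat_CARD[where 'a = 'q] by (simp add: assms(1))
  then have "(3::'q) = 0" unfolding mult_eq_0_iff by simp
  moreover have "x^9 = x" for x :: 'q using power_CARD_eq[of x] by (simp add: assms(1))
  ultimately interpret field_9 i by unfold_locales auto
  show ?thesis unfolding assms(2) by (rule not_synchronising_PSL2)
qed

end
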